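(* Let $m$ be an odd positive integer with $m = 2n - 1$, where $n \ge 2$, and write $m = 2^p \cdot (2q+1) - 1$ with $p \ge 1$, $q \ge 0$ (so $2^p$ is the exact power of $2$ dividing $m+1$). Then $T^{p+2}(m-1) = T^{p+2}(m)$ if and only if $C(n) = 1$.
   Context: $T:\mathbb{Z}^+\to\mathbb{Z}^+$ is defined by $T(x) = x/2$ if $x$ is even and $T(x) = (3x+1)/2$ if $x$ is odd; $T^k$ denotes the $k$-fold composition of $T$ with itself, with $T^0$ the identity. The function $C:\mathbb{Z}^+\to\{0,1\}$ is defined recursively by $C(1) = 0$, $C(n) = 1 - C(n-2)$ if $n > 1$ is odd, and $C(n) = 1 - C(n/2)$ if $n$ is even. *)

theory Defs
  imports Main
begin

text \<open>
  The positive integers are the nonzero elements of \<^typ>\<open>nat\<close>; the values of the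
  functions below at 0 are junk.
\<close>

definition T :: "nat \<Rightarrow> nat" where
  "T x = (if even x then x div 2 else (3 * x + 1) div 2)"

lemma T_pos: "x > 0 \<Longrightarrow> T x > 0"
  by (cases "even x") (auto simp: T_def elim!: evenE oddE)

text \<open>Integer-valued, so that \<open>1 - C _\<close> is not truncated subtraction.\<close>

fun C :: "nat \<Rightarrow> int" where
  "C n = (if n \<le> 1 then 0
          else if odd n then 1 - C (n - 2)
          else 1 - C (n div 2))"

declare C.simps [simp del]

lemma C_range: "C n \<in> {0, 1}"
proof (induction n rule: C.induct)
  case (1 n)
  then show ?case
    by (subst C.simps) auto
qed

lemma C_one: "C 1 = 0"
  by (simp add: C.simps)

lemma C_odd: "n > 1 \<Longrightarrow> odd n \<Longrightarrow> C n = 1 - C (n - 2)"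
  by (subst C.simps) simp

lemma C_even: "n > 0 \<Longrightarrow> even n \<Longrightarrow> C n = 1 - C (n div 2)"
  by (subst C.simps) (auto simp: le_Suc_eq)

end

theory Submission
  imports Defs
begin

text \<open>
  Write \<open>a = 3 ^ (p - 1) * (2 * q + 1)\<close>. After \<open>p + 1\<close> steps \<open>m - 1\<close> has reached
  \<open>x = (a - 1) / 2\<close> and \<open>m\<close> has reached \<open>(3 * a - 1) / 2 = 3 * x + 1\<close>. One more step merges
  these two numbers if and only if \<open>x\<close> is odd, i.e. \<open>a \<equiv> 3 (mod 4)\<close>, i.e. \<open>p - 1 + q\<close> is odd;
  and \<open>C n\<close> is the parity of \<open>p - 1 + q\<close>, because \<open>n = 2 ^ (p - 1) * (2 * q + 1)\<close>.
\<close>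

lemma T_double: "T (2 * x) = x"
  by (simp add: T_def)

lemma T_double_minus_1: "b > 0 \<Longrightarrow> T (2 * b - 1) = 3 * b - 1"
  by (cases b) (simp_all add: T_def)

text \<open>\<open>T\<close> sends \<open>2 * b - 1\<close> to \<open>3 * b - 1\<close>, so each
  step trades one factor 2 for a factor 3.\<close>

lemma funpow_T_power2_minus_1:
  "a > 0 \<Longrightarrow> (T ^^ k) (2 ^ k * a - 1) = 3 ^ k * a - 1"
proof (induction k arbitrary: a)
  case (Suc k)
  have "T (2 ^ Suc k * a - 1) = 2 ^ k * (3 * a) - 1"
    using T_double_minus_1[of "2 ^ k * a"] Suc.prems by (simp add: mult_ac)
  then show ?case
    using Suc.IH[of "3 * a"] Suc.prems
    by (simp add: funpow_swap1 mult_ac)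
qed simp

text \<open>For odd \<open>x\<close> both sides are \<open>(3 * x + 1) / 2\<close>; for even
  \<open>x\<close>, \<open>3 * x + 1\<close> is odd and its image exceeds
  \<open>x / 2\<close>.\<close>

lemma T_eq_T_3x_plus_1_iff: "T x = T (3 * x + 1) \<longleftrightarrow> odd x"
  by (cases "even x") (auto simp: T_def elim!: evenE)

lemma C_odd_eq_1_iff: "C (2 * q + 1) = 1 \<longleftrightarrow> odd q"
proof (induction q)
  case 0
  then show ?case using C_one by simp
next
  case (Suc q)
  then show ?case
    using C_odd[of "2 * Suc q + 1"] C_range[of "2 * q + 1"] by auto
qed

lemma C_eq_1_iff: "C (2 ^ k * (2 * q + 1)) = 1 \<longleftrightarrow> odd (k + q)"
proof (induction k)
  case 0
  then show ?case using C_odd_eq_1_iff[of q] by simp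
next
  case (Suc k)
  have "C (2 ^ Suc k * (2 * q + 1)) = 1 - C (2 ^ k * (2 * q + 1))"
    using C_even[of "2 ^ Suc k * (2 * q + 1)"] by (simp add: mult.assoc del: mult_Suc_right)
  then show ?case
    using Suc.IH C_range[of "2 ^ k * (2 * q + 1)"] by auto
qed

text \<open>Tripling \<open>2 * x + 1\<close> replaces \<open>x\<close> by \<open>3 * x + 1\<close>,
  which has the opposite parity.\<close>

lemma power3_times_odd_decomp:
  obtains x :: nat where "3 ^ k * (2 * q + 1) = 2 * x + 1" "odd x \<longleftrightarrow> odd (k + q)"
proof -
  have "\<exists>x::nat. 3 ^ k * (2 * q + 1) = 2 * x + 1 \<and> (odd x \<longleftrightarrow> odd (k + q))"
  proof (induction k)
    case (Suc k)
    then obtain x :: nat where "3 ^ k * (2 * q + 1) = 2 * x + 1" "odd x \<longleftrightarrow> odd (k + q)"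
      by blast
    then have "3 ^ Suc k * (2 * q + 1) = 2 * (3 * x + 1) + 1"
      "odd (3 * x + 1) \<longleftrightarrow> odd (Suc k + q)"
      by auto
    then show ?case by blast
  qed simp
  then show thesis using that by blast
qed

theorem theorem4p1:
  fixes m n p q :: nat
  assumes "odd m"
    and "n \<ge> 2"
    and "m = 2 * n - 1"
    and "p \<ge> 1"
    and "m = 2 ^ p * (2 * q + 1) - 1"
  shows "(T ^^ (p + 2)) (m - 1) = (T ^^ (p + 2)) m \<longleftrightarrow> C n = 1"
proof -
  from \<open>p \<ge> 1\<close> obtain k where p: "p = Suc k"
    by (cases p) auto
  define r where "r = 2 * q + 1"
  obtain x where x: "3 ^ k * r = 2 * x + 1" "odd x \<longleftrightarrow> odd (k + q)"
    using power3_times_odd_decomp unfolding r_def by blast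
  have r: "r > 0" by (simp add: r_def)
  have m: "m = 2 ^ p * r - 1" using assms(5) by (simp add: r_def)
  have pos: "2 ^ k * r > 0" using r by simp
  have n: "n = 2 ^ k * r"
    using assms(2,3) m pos unfolding p power_Suc by linarith
  have m1: "m - 1 = 2 * (2 ^ k * r - 1)"
    unfolding m p by (simp add: diff_mult_distrib2)
  \<comment> \<open>Here \<open>3 ^ p * r - 1 = 3 * (2 * x + 1) - 1\<close>.\<close>
  have "(T ^^ p) m = 2 * (3 * x + 1)"
    using funpow_T_power2_minus_1[OF r, of p] x(1) unfolding m p by (simp add: mult.assoc)
  then have Tm: "(T ^^ (p + 2)) m = T (3 * x + 1)"
    using T_double[of "3 * x + 1"] by simp
  \<comment> \<open>The first step halves \<open>m - 1\<close>; the other \<open>k\<close> steps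
    lead from \<open>2 ^ k * r - 1\<close> to \<open>3 ^ k * r - 1\<close>.\<close>
  have "(T ^^ p) (m - 1) = 2 * x"
    using funpow_T_power2_minus_1[OF r, of k] x(1)
    unfolding p m1 by (simp add: funpow_Suc_right T_double del: funpow.simps)
  then have "(T ^^ (p + 2)) (m - 1) = T x"
    by (simp add: T_double)
  then have "(T ^^ (p + 2)) (m - 1) = (T ^^ (p + 2)) m \<longleftrightarrow> odd x"
    using Tm T_eq_T_3x_plus_1_iff by simp
  also have "\<dots> \<longleftrightarrow> C n = 1"
    using x(2) C_eq_1_iff[of k q] by (simp add: n r_def)
  finally show ?thesis .
qed

end
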